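(* Let $\theta \geq 95^{\circ}$ (with $\theta<180^\circ$), and let $R\gg 1$ be sufficiently large. Then there exist a real-valued weight function $\phi(t,x)$ on $(0,1)\times(\Omega_\theta\setminus B_R(0))$, a constant $C>0$ with $$|\phi(t,x)| < C\,\frac{|x|^2}{t} \quad\text{for all } (t,x)\in (0,1)\times(\Omega_\theta\setminus B_R(0)),$$ and constants $\tau_0>0$, $K>0$ such that for all $\tau\ge\tau_0$ and all $u\in C_0^\infty\big((0,1)\times(\Omega_\theta\setminus B_R(0))\big)$, $$\tau \left\| e^{\tau \phi}\frac{(1-t)^{\frac{1}{2}}}{t} u \right\|_{L^2}+ \tau^{\frac{1}{2}}\left\| e^{\tau \phi} u \right\|_{L^2}+\left\| e^{\tau \phi}\nabla u \right\|_{L^2} \le K \left\| e^{\tau \phi}(\partial_t + \Delta)u \right\|_{L^{2}}.$$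
   Context: For $0<\theta<\pi$ (180°), $\Omega_{\theta}= \{ (x_{1},x_{2})\in \mathbb{R}^2 : x_1\ge 0,\ |x_2|\le x_1\tan(\theta/2)\}$ is the planar cone with opening angle $\theta$. $B_R(0)$ is the ball of radius $R$ centred at the origin. $\nabla$ and $\Delta$ are the gradient and Laplacian in the spatial variable $x\in\mathbb{R}^2$, $t$ is the time variable, and the $L^2$ norms are over space-time $(0,1)\times\Omega_\theta$ with respect to $dx\,dt$. $C_0^\infty((0,1)\times(\Omega_\theta\setminus B_R(0)))$ denotes smooth real-valued functions with compact support in the interior of $(0,1)\times(\Omega_\theta\setminus B_R(0))$. *)

theory Defs
  imports "HOL-Analysis.Analysis"
begin

(* The angle is in radians. *)
definition planar_cone :: "real \<Rightarrow> (real ^ 2) set" where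
  "planar_cone \<theta> = {x. x $ 1 \<ge> 0 \<and> \<bar>x $ 2\<bar> \<le> x $ 1 * tan (\<theta> / 2)}"

definition spacetime_cone :: "real \<Rightarrow> (real \<times> (real ^ 2)) set" where
  "spacetime_cone \<theta> = {0<..<1} \<times> planar_cone \<theta>"

definition truncated_spacetime_cone :: "real \<Rightarrow> real \<Rightarrow> (real \<times> (real ^ 2)) set" where
  "truncated_spacetime_cone \<theta> R = {0<..<1} \<times> (planar_cone \<theta> - ball 0 R)"

(* Only meaningful where f is differentiable, as is required in Ck below. *)
definition partial_deriv :: "'a::real_normed_vector \<Rightarrow> ('a \<Rightarrow> real) \<Rightarrow> 'a \<Rightarrow> real" where
  "partial_deriv b f = (\<lambda>p. frechet_derivative f (at p) b)"

primrec Ck :: "nat \<Rightarrow> ('a::euclidean_space \<Rightarrow> real) \<Rightarrow> bool" where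
  "Ck 0 f \<longleftrightarrow> continuous_on UNIV f"
| "Ck (Suc k) f \<longleftrightarrow>
     (\<forall>p. f differentiable (at p)) \<and> (\<forall>b\<in>Basis. Ck k (partial_deriv b f))"

definition smooth :: "('a::euclidean_space \<Rightarrow> real) \<Rightarrow> bool" where
  "smooth f \<longleftrightarrow> (\<forall>k. Ck k f)"

(* Smooth functions with compact support in the interior of D; every such function is
   identified with its extension by zero, which is smooth on the whole space. *)
definition test_functions :: "'a::euclidean_space set \<Rightarrow> ('a \<Rightarrow> real) set" where
  "test_functions D =
     {u. smooth u \<and> compact (closure {p. u p \<noteq> 0}) \<and> closure {p. u p \<noteq> 0} \<subseteq> interior D}"

(* Points of space-time are pairs (t, x); the gradient and Laplacian act on x only. *)
definition time_deriv :: "(real \<times> (real ^ 2) \<Rightarrow> real) \<Rightarrow> real \<times> (real ^ 2) \<Rightarrow> real" where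
  "time_deriv u = partial_deriv (1, 0) u"

definition space_deriv :: "2 \<Rightarrow> (real \<times> (real ^ 2) \<Rightarrow> real) \<Rightarrow> real \<times> (real ^ 2) \<Rightarrow> real" where
  "space_deriv i u = partial_deriv (0, axis i 1) u"

definition gradient :: "(real \<times> (real ^ 2) \<Rightarrow> real) \<Rightarrow> real \<times> (real ^ 2) \<Rightarrow> real ^ 2" where
  "gradient u p = (\<chi> i. space_deriv i u p)"

definition laplacian :: "(real \<times> (real ^ 2) \<Rightarrow> real) \<Rightarrow> real \<times> (real ^ 2) \<Rightarrow> real" where
  "laplacian u p = (\<Sum>i\<in>UNIV. space_deriv i (space_deriv i u) p)"

(* The Bochner integral of a non-integrable function is 0, so this is the L2 norm only for
   square-integrable f.  For the functions it is applied to, square-integrability follows from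
   the measurability and the pointwise bound of the weight: on the compact support of a test
   function t is bounded away from 0 and |x| is bounded, so the weight is bounded there. *)
definition L2_norm_on :: "'a::euclidean_space set \<Rightarrow> ('a \<Rightarrow> 'b::real_normed_vector) \<Rightarrow> real" where
  "L2_norm_on S f = sqrt (LINT p:S|lborel. (norm (f p))\<^sup>2)"

end

(* Take the weight phi(t,x) = (1/t - 1) x_1.  For v = e^(tau phi) u, the conjugated operator
   e^(tau phi) (d_t + Laplacian) e^(-tau phi) = S + N splits into the symmetric part
   S = Laplacian + f with f = tau^2 (1/t - 1)^2 + tau x_1 / t^2 and the antisymmetric part
   N = d_t - 2 tau (1/t - 1) d_1, whose commutator is multiplication by
   Q = 4 tau^2 (1/t - 1) / t^2 + 2 tau x_1 / t^3.  Hence the integral of ((S + N) v)^2 equals that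
   of (S v)^2 + (N v)^2 + Q v^2.  Since x_1 >= 1 on the truncated cone once R >= 1 / cos(theta/2),
   Q dominates both tau^2 (1 - t) / t^2 and tau.  The gradient term comes from integrating
   div(v grad v) = |grad v|^2 + v S v - f v^2. *)
theory Submission
  imports Defs
begin

section \<open>Mean values along lines and the symmetry of mixed derivatives\<close>

lemma DERIV_shift_line:
  fixes f :: "'a::real_normed_vector \<Rightarrow> real"
  assumes "\<And>p. ((\<lambda>h. f (p + h *\<^sub>R b)) has_real_derivative g p) (at 0)"
  shows "((\<lambda>h. f (p + h *\<^sub>R b)) has_real_derivative g (p + x *\<^sub>R b)) (at x)"
proof -
  have "(\<lambda>h. f (p + x *\<^sub>R b + h *\<^sub>R b)) = (\<lambda>h. f (p + (h + x) *\<^sub>R b))"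
    by (simp add: algebra_simps scaleR_add_left)
  then show ?thesis
    using assms[of "p + x *\<^sub>R b"] DERIV_shift[of "\<lambda>h. f (p + h *\<^sub>R b)" _ 0 x] by simp
qed

lemma line_MVT:
  fixes f :: "'a::real_normed_vector \<Rightarrow> real"
  assumes "\<And>p. ((\<lambda>h. f (p + h *\<^sub>R b)) has_real_derivative g p) (at 0)" and "0 < h"
  obtains z where "0 < z" "z < h" "f (p + h *\<^sub>R b) - f p = h * g (p + z *\<^sub>R b)"
proof -
  have "\<exists>z>0. z < h \<and> f (p + h *\<^sub>R b) - f (p + 0 *\<^sub>R b) = (h - 0) * g (p + z *\<^sub>R b)"
    by (rule MVT2[OF assms(2)]) (rule DERIV_shift_line[OF assms(1)])
  then show thesis using that by auto
qed

text \<open>The second difference is the increment along \<open>a\<close> of the increment of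
  \<open>f\<close> along \<open>b\<close>. A mean value in direction \<open>a\<close> turns it into
  an increment of \<open>fa\<close> along \<open>b\<close>, and a second one in direction
  \<open>b\<close> reaches \<open>fab\<close>.\<close>

lemma second_difference_MVT:
  fixes f :: "'a::real_normed_vector \<Rightarrow> real"
  assumes fa: "\<And>p. ((\<lambda>h. f (p + h *\<^sub>R a)) has_real_derivative fa p) (at 0)"
    and fab: "\<And>p. ((\<lambda>h. fa (p + h *\<^sub>R b)) has_real_derivative fab p) (at 0)"
    and h: "0 < h"
  shows "\<exists>y z. 0 < y \<and> y < h \<and> 0 < z \<and> z < h \<and>
    f (p + h *\<^sub>R a + h *\<^sub>R b) - f (p + h *\<^sub>R a) - f (p + h *\<^sub>R b) + f p
      = h\<^sup>2 * fab (p + y *\<^sub>R a + z *\<^sub>R b)"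
proof -
  define g where "g q = f (q + h *\<^sub>R b) - f q" for q
  have "((\<lambda>k. g (q + k *\<^sub>R a)) has_real_derivative (fa (q + h *\<^sub>R b) - fa q)) (at 0)" for q
    unfolding g_def using fa[of "q + h *\<^sub>R b"] fa[of q]
    by (intro DERIV_diff) (simp_all add: algebra_simps)
  then obtain y where y: "0 < y" "y < h"
    "g (p + h *\<^sub>R a) - g p = h * (fa (p + y *\<^sub>R a + h *\<^sub>R b) - fa (p + y *\<^sub>R a))"
    using line_MVT[of g a "\<lambda>q. fa (q + h *\<^sub>R b) - fa q" h p] h by metis
  obtain z where z: "0 < z" "z < h"
    "fa (p + y *\<^sub>R a + h *\<^sub>R b) - fa (p + y *\<^sub>R a) = h * fab (p + y *\<^sub>R a + z *\<^sub>R b)"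
    using line_MVT[of fa b fab h "p + y *\<^sub>R a"] fab h by metis
  have "f (p + h *\<^sub>R a + h *\<^sub>R b) - f (p + h *\<^sub>R a) - f (p + h *\<^sub>R b) + f p
      = h\<^sup>2 * fab (p + y *\<^sub>R a + z *\<^sub>R b)"
    using y(3) z(3) by (simp add: g_def power2_eq_square)
  with y z show ?thesis by blast
qed

lemma second_difference_quotient_tendsto:
  fixes f :: "'a::real_normed_vector \<Rightarrow> real"
  assumes fa: "\<And>p. ((\<lambda>h. f (p + h *\<^sub>R a)) has_real_derivative fa p) (at 0)"
    and fab: "\<And>p. ((\<lambda>h. fa (p + h *\<^sub>R b)) has_real_derivative fab p) (at 0)"
    and cont: "continuous_on UNIV fab"
    and h: "\<And>n. 0 < h n" "h \<longlonglongrightarrow> 0"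
  shows "(\<lambda>n. (f (p + h n *\<^sub>R a + h n *\<^sub>R b) - f (p + h n *\<^sub>R a) - f (p + h n *\<^sub>R b) + f p) / (h n)\<^sup>2)
    \<longlonglongrightarrow> fab p"
proof -
  have "\<forall>n. \<exists>y z. 0 < y \<and> y < h n \<and> 0 < z \<and> z < h n \<and>
    f (p + h n *\<^sub>R a + h n *\<^sub>R b) - f (p + h n *\<^sub>R a) - f (p + h n *\<^sub>R b) + f p
      = (h n)\<^sup>2 * fab (p + y *\<^sub>R a + z *\<^sub>R b)"
    using second_difference_MVT[OF fa fab] h(1) by blast
  then obtain y z where yz: "\<And>n. 0 < y n" "\<And>n. y n < h n" "\<And>n. 0 < z n" "\<And>n. z n < h n"
    and eq: "\<And>n. f (p + h n *\<^sub>R a + h n *\<^sub>R b) - f (p + h n *\<^sub>R a) - f (p + h n *\<^sub>R b) + f p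
      = (h n)\<^sup>2 * fab (p + y n *\<^sub>R a + z n *\<^sub>R b)"
    by metis
  have y0: "y \<longlonglongrightarrow> 0" and z0: "z \<longlonglongrightarrow> 0"
    by (rule real_tendsto_sandwich[OF _ _ tendsto_const h(2)];
        use yz in \<open>auto intro!: always_eventually less_imp_le\<close>)+
  have "(\<lambda>n. p + y n *\<^sub>R a + z n *\<^sub>R b) \<longlonglongrightarrow> p + 0 *\<^sub>R a + 0 *\<^sub>R b"
    by (intro tendsto_intros y0 z0)
  then have "(\<lambda>n. fab (p + y n *\<^sub>R a + z n *\<^sub>R b)) \<longlonglongrightarrow> fab p"
    using continuous_on_tendsto_compose[OF cont] by simp
  moreover have "(f (p + h n *\<^sub>R a + h n *\<^sub>R b) - f (p + h n *\<^sub>R a) - f (p + h n *\<^sub>R b) + f p) / (h n)\<^sup>2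
      = fab (p + y n *\<^sub>R a + z n *\<^sub>R b)" for n
    using eq[of n] h(1)[of n] by simp
  ultimately show ?thesis by simp
qed

text \<open>The second difference quotient is symmetric in \<open>a\<close> and \<open>b\<close>, so
  taking its limit in the two orders identifies the two mixed derivatives.\<close>

lemma directional_derivatives_commute:
  fixes f :: "'a::real_normed_vector \<Rightarrow> real"
  assumes fa: "\<And>p. ((\<lambda>h. f (p + h *\<^sub>R a)) has_real_derivative fa p) (at 0)"
    and fab: "\<And>p. ((\<lambda>h. fa (p + h *\<^sub>R b)) has_real_derivative fab p) (at 0)"
    and fb: "\<And>p. ((\<lambda>h. f (p + h *\<^sub>R b)) has_real_derivative fb p) (at 0)"
    and fba: "\<And>p. ((\<lambda>h. fb (p + h *\<^sub>R a)) has_real_derivative fba p) (at 0)"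
    and "continuous_on UNIV fab" "continuous_on UNIV fba"
  shows "fab p = fba p"
proof -
  define h :: "nat \<Rightarrow> real" where "h n = inverse (real (Suc n))" for n
  have h: "\<And>n. 0 < h n" "h \<longlonglongrightarrow> 0"
    using LIMSEQ_inverse_real_of_nat by (simp_all add: h_def[abs_def])
  show ?thesis
    using second_difference_quotient_tendsto[OF fa fab assms(5) h, of p]
      second_difference_quotient_tendsto[OF fb fba assms(6) h, of p]
    by (intro LIMSEQ_unique) (simp_all add: algebra_simps)
qed

section \<open>Integrals of derivatives of compactly supported functions\<close>

lemma continuous_on_UNIV_extension_by_zero:
  fixes f :: "'a::topological_space \<Rightarrow> 'b::{topological_space, zero}"
  assumes "closed K" "open U" "K \<subseteq> U" "continuous_on U f" "\<And>p. p \<notin> K \<Longrightarrow> f p = 0"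
  shows "continuous_on UNIV f"
proof -
  have "continuous_on (- K) f"
    using assms(5) continuous_on_const[of "- K" 0] by (subst continuous_on_cong[OF refl, of _ f "\<lambda>_. 0"]) auto
  then have "continuous_on (U \<union> - K) f"
    using assms by (intro continuous_on_open_Un) auto
  moreover have "U \<union> - K = UNIV" using assms(3) by auto
  ultimately show ?thesis by simp
qed

lemma integrable_continuous_on_compact:
  fixes f :: "'a::euclidean_space \<Rightarrow> real"
  assumes "compact K" "continuous_on K f" "\<And>p. p \<notin> K \<Longrightarrow> f p = 0"
  shows "integrable lborel f"
proof -
  have "(\<lambda>p. indicator K p *\<^sub>R f p) = f"
    using assms(3) by (intro ext) (auto simp: indicator_def)
  then show ?thesis using borel_integrable_compact[OF assms(1,2)] by simp
qed

lemma integral_lborel_translation: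
  fixes f :: "'a::euclidean_space \<Rightarrow> real"
  assumes "f \<in> borel_measurable borel"
  shows "(\<integral>p. f (p + c) \<partial>lborel) = (\<integral>p. f p \<partial>lborel)"
proof -
  have "(\<integral>p. f p \<partial>lborel) = (\<integral>p. f p \<partial>distr lborel borel ((+) c))"
    by (simp add: lborel_distr_plus)
  also have "\<dots> = (\<integral>p. f (c + p) \<partial>lborel)"
    using assms by (intro integral_distr) auto
  finally show ?thesis by (simp add: add.commute)
qed

text \<open>Difference quotients integrate to zero by translation invariance; dominated convergence
  carries this over to the derivative, so no iterated integrals are needed.\<close>

lemma integral_directional_derivative_eq_0:
  fixes f g :: "'a::euclidean_space \<Rightarrow> real"
  assumes K: "compact K" "K \<subseteq> U" and U: "open U"
    and cont: "continuous_on U f" "continuous_on U g"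
    and zero: "\<And>p. p \<notin> K \<Longrightarrow> f p = 0" "\<And>p. p \<notin> K \<Longrightarrow> g p = 0"
    and der: "\<And>p. p \<in> U \<Longrightarrow> ((\<lambda>h. f (p + h *\<^sub>R b)) has_real_derivative g p) (at 0)"
  shows "(\<integral>p. g p \<partial>lborel) = 0"
proof -
  have clK: "closed K" using K(1) by (rule compact_imp_closed)
  have contf: "continuous_on UNIV f" and contg: "continuous_on UNIV g"
    using continuous_on_UNIV_extension_by_zero[OF clK U K(2)] cont zero by blast+
  \<comment> \<open>A point outside \<open>U\<close> has a positive distance from the closed set
    \<open>K\<close>, so \<open>f\<close> vanishes near it and the derivative 0 agrees with
    \<open>g\<close>.\<close>
  have deriv: "((\<lambda>h. f (p + h *\<^sub>R b)) has_real_derivative g p) (at 0)" for p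
  proof (cases "p \<in> U")
    case False
    then have p: "p \<notin> K" using K(2) by auto
    have "open ((\<lambda>h::real. p + h *\<^sub>R b) -` (- K))"
      using clK by (intro open_vimage continuous_intros) auto
    then have "((\<lambda>h. f (p + h *\<^sub>R b)) has_real_derivative 0) (at 0)"
      by (rule has_field_derivative_transform_within_open[OF DERIV_const[of 0 "at 0"]])
        (use p zero(1) in simp_all)
    then show ?thesis using zero(2)[OF p] by simp
  qed (rule der)
  obtain r where r: "\<And>p. p \<in> K \<Longrightarrow> norm p \<le> r"
    using compact_imp_bounded[OF K(1)] unfolding bounded_iff by blast
  have "bounded (g ` K)"
    using K(1) contg by (intro compact_imp_bounded compact_continuous_image) (auto intro: continuous_on_subset)
  then obtain B where B: "\<And>p. p \<in> K \<Longrightarrow> \<bar>g p\<bar> \<le> B" "0 < B"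
    unfolding bounded_pos by auto
  have B': "\<bar>g p\<bar> \<le> B" for p using B zero(2)[of p] by (cases "p \<in> K") auto
  define h :: "nat \<Rightarrow> real" where "h n = inverse (real (Suc n))" for n
  have h: "0 < h n" "h n \<le> 1" for n by (auto simp: h_def field_simps)
  have h0: "h \<longlonglongrightarrow> 0" using LIMSEQ_inverse_real_of_nat by (simp add: h_def[abs_def])
  define s where "s n p = (f (p + h n *\<^sub>R b) - f p) / h n" for n p
  have [measurable]: "f \<in> borel_measurable borel" "g \<in> borel_measurable borel"
    using contf contg by (auto intro: borel_measurable_continuous_onI)
  have intf: "integrable lborel f"
    using K(1) zero(1) by (intro integrable_continuous_on_compact[of K]) (auto intro: continuous_on_subset[OF contf])
  \<comment> \<open>By the mean value theorem \<open>s n p\<close> is a value of \<open>g\<close> at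
    distance at most \<open>norm b\<close> from \<open>p\<close>, because
    \<open>h n \<le> 1\<close>. Hence it is bounded by \<open>B\<close> and vanishes outside the
    ball of radius \<open>r + norm b\<close>, uniformly in \<open>n\<close>.\<close>
  have "(\<lambda>n. integral\<^sup>L lborel (s n)) \<longlonglongrightarrow> integral\<^sup>L lborel g"
  proof (rule integral_dominated_convergence[where w = "\<lambda>p. indicator (cball 0 (r + norm b)) p *\<^sub>R B"])
    show "integrable lborel (\<lambda>p. indicator (cball (0::'a) (r + norm b)) p *\<^sub>R B)"
      by (intro borel_integrable_compact) auto
    show "s n \<in> borel_measurable lborel" for n
      unfolding s_def by measurable
    show "AE p in lborel. (\<lambda>n. s n p) \<longlonglongrightarrow> g p"
    proof (rule AE_I2)
      fix p
      have "((\<lambda>k. (f (p + k *\<^sub>R b) - f p) / k) \<longlongrightarrow> g p) (at 0)"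
        using deriv[of p] by (simp add: has_field_derivative_iff)
      moreover have "filterlim h (at 0) sequentially"
        using h0 h(1) less_imp_neq[OF h(1)] by (auto simp: filterlim_at intro!: always_eventually)
      ultimately show "(\<lambda>n. s n p) \<longlonglongrightarrow> g p"
        unfolding s_def by (rule filterlim_compose)
    qed
    show "AE p in lborel. norm (s n p) \<le> indicator (cball 0 (r + norm b)) p *\<^sub>R B" for n
    proof (rule AE_I2)
      fix p
      obtain z where z: "0 < z" "z < h n" "f (p + h n *\<^sub>R b) - f p = h n * g (p + z *\<^sub>R b)"
        using line_MVT[of f b g "h n" p] deriv h(1) by metis
      then have eq: "s n p = g (p + z *\<^sub>R b)" using h(1)[of n] by (simp add: s_def)
      show "norm (s n p) \<le> indicator (cball 0 (r + norm b)) p *\<^sub>R B"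
      proof (cases "p + z *\<^sub>R b \<in> K")
        case True
        have "norm p \<le> norm (p + z *\<^sub>R b) + norm (z *\<^sub>R b)"
          using norm_triangle_ineq4[of "p + z *\<^sub>R b" "z *\<^sub>R b"] by simp
        also have "\<dots> \<le> r + norm b"
          using r[OF True] z h(2)[of n] mult_right_mono[of "\<bar>z\<bar>" 1 "norm b"] by simp
        finally show ?thesis using B' eq by simp
      next
        case False
        then show ?thesis using zero(2) eq B(2) by simp
      qed
    qed
  qed simp_all
  moreover have "integral\<^sup>L lborel (s n) = 0" for n
  proof -
    have "integrable lborel (\<lambda>p. f (p + h n *\<^sub>R b))"
      using intf integrable_distr_eq[of "(+) (h n *\<^sub>R b)" lborel borel f]
      by (simp add: lborel_distr_plus add.commute)
    then show ?thesis
      unfolding s_def using intf by (simp add: integral_lborel_translation)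
  qed
  ultimately show ?thesis by (simp add: LIMSEQ_const_iff)
qed

section \<open>Partial derivatives of smooth functions\<close>

lemma Ck_imp_continuous_on: "Ck k f \<Longrightarrow> continuous_on UNIV f"
  by (cases k) (auto intro!: differentiable_imp_continuous_on simp: differentiable_on_def differentiable_at_withinI)

lemma smooth_imp_continuous_on: "smooth f \<Longrightarrow> continuous_on UNIV f"
  using Ck_imp_continuous_on smooth_def by blast

lemma smooth_partial_deriv: "smooth f \<Longrightarrow> b \<in> Basis \<Longrightarrow> smooth (partial_deriv b f)"
  unfolding smooth_def using Ck.simps(2) by blast

text \<open>Turns the Frechet derivative behind \<open>partial_deriv\<close> into a one-variable
  derivative along a line, the form in which mean values and integration are treated above.\<close>

lemma smooth_DERIV_line:
  assumes "smooth f"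
  shows "((\<lambda>h. f (p + h *\<^sub>R b)) has_real_derivative partial_deriv b f p) (at 0)"
proof -
  have "f differentiable (at p)" using assms by (metis Ck.simps(2) smooth_def)
  then have D: "(f has_derivative frechet_derivative f (at p)) (at (p + 0 *\<^sub>R b))"
    by (simp add: frechet_derivative_works)
  have "((\<lambda>h::real. p + h *\<^sub>R b) has_derivative (\<lambda>h. h *\<^sub>R b)) (at 0)"
    by (auto intro!: derivative_eq_intros)
  from diff_chain_at[OF this D] have
    "((\<lambda>h. f (p + h *\<^sub>R b)) has_derivative (\<lambda>h. frechet_derivative f (at p) (h *\<^sub>R b))) (at 0)"
    by (simp add: o_def)
  moreover have "(\<lambda>h. frechet_derivative f (at p) (h *\<^sub>R b)) = (*) (frechet_derivative f (at p) b)"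
    using linear_cmul[OF has_derivative_linear[OF D]] by (simp add: fun_eq_iff)
  ultimately show ?thesis
    unfolding has_field_derivative_def partial_deriv_def by simp
qed

text \<open>The complement of \<open>K\<close> is open, so \<open>f\<close> is zero near
  \<open>p\<close>. This keeps all derivatives of a test function supported in the same compact
  set.\<close>

lemma partial_deriv_eq_0:
  assumes "closed K" "\<And>p. p \<notin> K \<Longrightarrow> f p = 0" "p \<notin> K"
  shows "partial_deriv b f p = 0"
proof -
  have "(f has_derivative (\<lambda>_. 0)) (at p)"
    by (rule has_derivative_transform_within_open[OF has_derivative_const[of 0], where s = "- K"])
      (use assms in auto)
  then show ?thesis
    by (metis frechet_derivative_at partial_deriv_def)
qed

lemma partial_deriv_commute:
  assumes "smooth f" "a \<in> Basis" "b \<in> Basis"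
  shows "partial_deriv b (partial_deriv a f) p = partial_deriv a (partial_deriv b f) p"
proof -
  note sa = smooth_partial_deriv[OF assms(1,2)] and sb = smooth_partial_deriv[OF assms(1,3)]
  show ?thesis
    by (rule directional_derivatives_commute[OF smooth_DERIV_line[OF assms(1)] smooth_DERIV_line[OF sa]
          smooth_DERIV_line[OF assms(1)] smooth_DERIV_line[OF sb]
          smooth_imp_continuous_on[OF smooth_partial_deriv[OF sa assms(3)]]
          smooth_imp_continuous_on[OF smooth_partial_deriv[OF sb assms(2)]]])
qed

section \<open>Pointwise algebra of the commutator\<close>

text \<open>Here \<open>B\<close> stands for \<open>1 / t\<close>, \<open>v1t\<close> for \<open>\<partial>\<^sub>1 \<partial>\<^sub>t v\<close> and so on; \<open>divT\<close>, \<open>div1\<close>, \<open>div2\<close> are the partial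
  derivatives (in \<open>t\<close>, \<open>x\<^sub>1\<close>, \<open>x\<^sub>2\<close>) of the fields \<open>FT\<close>, \<open>F1\<close>, \<open>F2\<close> in \<open>carleman_divergence\<close>, whose
  part \<open>v \<nabla>v\<close> yields the gradient term and whose remainder turns the cross term \<open>2 (S v) (N v)\<close>
  into \<open>Q v\<^sup>2\<close>.\<close>

lemma carleman_pointwise:
  fixes B x s v vt v1 v2 v11 v12 v22 v1t v2t A c f divT div1 div2 :: real
  assumes "1 \<le> B" "1 \<le> x" "1 \<le> s"
  defines "A \<equiv> B - 1" and "c \<equiv> 2 * s * A" and "f \<equiv> s\<^sup>2 * A\<^sup>2 + s * x * B\<^sup>2"
    and "divT \<equiv> 2 * v1 * v1t + 2 * v2 * v2t + (2 * s\<^sup>2 * A * B\<^sup>2 + 2 * s * x * B ^ 3) * v\<^sup>2 - 2 * f * v * vt"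
    and "div1 \<equiv> v1\<^sup>2 + v * v11 - (2 * v11 * vt + 2 * v1 * v1t - 4 * c * v1 * v11
       + c * (2 * v1 * v11 + 2 * v2 * v12) - c * (s * B\<^sup>2) * v\<^sup>2 - 2 * c * f * v * v1)"
    and "div2 \<equiv> v2\<^sup>2 + v * v22 - (2 * v22 * vt + 2 * v2 * v2t - 2 * c * (v22 * v1 + v2 * v12))"
  shows "s\<^sup>2 * (A * B) * v\<^sup>2 + s * v\<^sup>2 + ((v1 - s * A * v)\<^sup>2 + v2\<^sup>2)
    \<le> 2 * (v11 + v22 + f * v + (vt - c * v1))\<^sup>2 + 2 * (divT + div1 + div2)"
proof -
  define Q where "Q = 4 * s\<^sup>2 * A * B\<^sup>2 + 2 * s * x * B ^ 3"
  define S where "S = v11 + v22 + f * v"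
  define N where "N = vt - c * v1"
  \<comment> \<open>A polynomial identity in which every derivative is an independent variable.
    \<open>Q\<close> collects minus the time derivative of \<open>f\<close>, namely
    \<open>2 * s\<^sup>2 * A * B\<^sup>2 + 2 * s * x * B ^ 3\<close>, and \<open>c\<close> times the
    \<open>x_1\<close>-derivative \<open>s * B\<^sup>2\<close> of \<open>f\<close>, which supplies
    another \<open>2 * s\<^sup>2 * A * B\<^sup>2\<close>.\<close>
  have id: "(S + N)\<^sup>2 + (divT + div1 + div2)
      = S\<^sup>2 + N\<^sup>2 + Q * v\<^sup>2 + v1\<^sup>2 + v2\<^sup>2 + v * S - f * v\<^sup>2"
    unfolding S_def N_def Q_def divT_def div1_def div2_def f_def c_def
    by (simp add: algebra_simps power2_eq_square power3_eq_cube)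
  have A0: "0 \<le> A" "A \<le> B" using assms(1) by (auto simp: A_def)
  have s1: "s \<le> s * x * B\<^sup>2" and s2: "s * x * B\<^sup>2 \<le> s * x * B ^ 3"
  proof -
    have "1 * 1 \<le> x * B\<^sup>2" using assms(1,2) by (intro mult_mono) auto
    then show "s \<le> s * x * B\<^sup>2" using assms(3) by (simp add: mult.assoc)
    show "s * x * B\<^sup>2 \<le> s * x * B ^ 3"
      using assms(1-3) by (intro mult_left_mono power_increasing) auto
  qed
  have s3: "s\<^sup>2 * (A * B) \<le> s\<^sup>2 * (A * B\<^sup>2)" "s\<^sup>2 * A\<^sup>2 \<le> s\<^sup>2 * (A * B)"
    using A0 assms(1) by (intro mult_left_mono self_le_power; simp add: power2_eq_square mult_left_mono)+
  \<comment> \<open>The left side lists what is charged to \<open>2 * Q\<close>: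
    \<open>a + s\<close> are the wanted terms of order zero, \<open>2 * b\<close> pays for passing
    from \<open>v1\<close> to \<open>v1 - s * A * v\<close>, \<open>2 * (b + y)\<close> is
    \<open>2 * f\<close>, and \<open>1 / 2\<close> pays for absorbing \<open>v * S\<close> into
    \<open>S\<^sup>2\<close>.\<close>
  have arith: "a + s + 2 * b + 2 * (b + y) + 1 / 2 \<le> 2 * Q"
    if "Q = 4 * z + 2 * r" "0 \<le> a" "s \<le> y" "y \<le> r" "a \<le> z" "b \<le> a" "1 \<le> s" for a b y z r :: real
    using that by argo
  have "Q = 4 * (s\<^sup>2 * (A * B\<^sup>2)) + 2 * (s * x * B ^ 3)"
    by (simp add: Q_def)
  moreover have "0 \<le> s\<^sup>2 * (A * B)" using A0 assms(1) by simp
  ultimately have "s\<^sup>2 * (A * B) + s + 2 * (s\<^sup>2 * A\<^sup>2) + 2 * f + 1 / 2 \<le> 2 * Q"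
    using arith[OF _ _ s1 s2 s3 assms(3)] unfolding f_def by blast
  then have "(s\<^sup>2 * (A * B) + s + 2 * (s\<^sup>2 * A\<^sup>2) + 2 * f + 1 / 2) * v\<^sup>2 \<le> 2 * Q * v\<^sup>2"
    by (intro mult_right_mono) auto
  moreover have "(v1 - s * A * v)\<^sup>2 \<le> 2 * v1\<^sup>2 + 2 * (s\<^sup>2 * A\<^sup>2) * v\<^sup>2"
    using zero_le_power2[of "v1 + s * A * v"] by (simp add: power2_eq_square algebra_simps)
  moreover have "0 \<le> 2 * S\<^sup>2 + 2 * (v * S) + v\<^sup>2 / 2"
    using zero_le_power2[of "S + v / 2"] by (simp add: power2_eq_square field_simps)
  ultimately have "s\<^sup>2 * (A * B) * v\<^sup>2 + s * v\<^sup>2 + ((v1 - s * A * v)\<^sup>2 + v2\<^sup>2)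
    \<le> 2 * ((S + N)\<^sup>2 + (divT + div1 + div2))"
    unfolding id distrib_right using zero_le_power2[of N] zero_le_power2[of v2] by argo
  then show ?thesis by (simp add: S_def N_def)
qed

section \<open>The divergence identity for the conjugated function\<close>

abbreviation basis_t :: "real \<times> (real ^ 2)" where "basis_t \<equiv> (1, 0)"
abbreviation basis_x :: "2 \<Rightarrow> real \<times> (real ^ 2)" where "basis_x i \<equiv> (0, axis i 1)"

lemma basis_in_Basis: "basis_t \<in> Basis" "basis_x i \<in> Basis"
  by (auto simp: Basis_prod_def axis_in_Basis_iff)

definition carleman_weight :: "real \<Rightarrow> real \<times> (real ^ 2) \<Rightarrow> real" where
  "carleman_weight s p = exp (s * ((inverse (fst p) - 1) * snd p $ 1))"

text \<open>\<open>G\<close> is twice a sum of partial derivatives of fields supported in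
  \<open>K\<close>, so it integrates to zero and no boundary terms arise. Its vanishing off
  \<open>K\<close> allows the inequality to be extended to the whole space before
  integrating.\<close>

lemma carleman_divergence:
  fixes u :: "real \<times> (real ^ 2) \<Rightarrow> real"
  assumes u: "smooth u" and K: "compact K" "\<And>p. p \<notin> K \<Longrightarrow> u p = 0"
    and KD: "\<And>p. p \<in> K \<Longrightarrow> 0 < fst p \<and> fst p < 1 \<and> 1 \<le> snd p $ 1" and s: "1 \<le> s"
  shows "\<exists>G. integrable lborel G \<and> (\<integral>p. G p \<partial>lborel) = 0 \<and> (\<forall>p. p \<notin> K \<longrightarrow> G p = 0) \<and>
    (\<forall>p\<in>K. s\<^sup>2 * ((inverse (fst p) - 1) * inverse (fst p)) * (carleman_weight s p * u p)\<^sup>2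
       + s * (carleman_weight s p * u p)\<^sup>2
       + (carleman_weight s p)\<^sup>2 * ((space_deriv 1 u p)\<^sup>2 + (space_deriv 2 u p)\<^sup>2)
     \<le> 2 * (carleman_weight s p * (time_deriv u p + laplacian u p))\<^sup>2 + G p)"
proof -
  \<comment> \<open>On this open neighbourhood of \<open>K\<close> the function \<open>1 / t\<close>
    is smooth. Continuity and derivatives are only required there, so the default value of
    \<open>inverse\<close> at 0 never enters.\<close>
  define U :: "(real \<times> (real ^ 2)) set" where "U = {p. 0 < fst p}"
  have U: "open U" unfolding U_def by (intro open_Collect_less continuous_intros)
  have KU: "K \<subseteq> U" using KD by (auto simp: U_def)
  define T where "T = basis_t"
  define X where "X = basis_x 1"
  define Y where "Y = basis_x 2"
  have Bas: "T \<in> Basis" "X \<in> Basis" "Y \<in> Basis"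
    unfolding T_def X_def Y_def by (rule basis_in_Basis)+
  define ut where "ut = partial_deriv T u"
  define ux where "ux = partial_deriv X u"
  define uy where "uy = partial_deriv Y u"
  define uxx where "uxx = partial_deriv X ux"
  define uxy where "uxy = partial_deriv Y ux"
  define uyy where "uyy = partial_deriv Y uy"
  define uxt where "uxt = partial_deriv T ux"
  define uyt where "uyt = partial_deriv T uy"
  note sm = u smooth_partial_deriv[OF u Bas(1), folded ut_def] smooth_partial_deriv[OF u Bas(2), folded ux_def]
    smooth_partial_deriv[OF u Bas(3), folded uy_def]
  note sm2 = smooth_partial_deriv[OF sm(3) Bas(1), folded uxt_def] smooth_partial_deriv[OF sm(3) Bas(2), folded uxx_def]
    smooth_partial_deriv[OF sm(3) Bas(3), folded uxy_def] smooth_partial_deriv[OF sm(4) Bas(1), folded uyt_def]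
    smooth_partial_deriv[OF sm(4) Bas(3), folded uyy_def]
  have comm: "partial_deriv X ut = uxt" "partial_deriv Y ut = uyt" "partial_deriv X uy = uxy"
    unfolding ut_def uxt_def uyt_def ux_def uy_def uxy_def
    using partial_deriv_commute[OF u] Bas by blast+
  have z1: "ut p = 0" "ux p = 0" "uy p = 0" if "p \<notin> K" for p
    unfolding ut_def ux_def uy_def
    using partial_deriv_eq_0[OF compact_imp_closed[OF K(1)] K(2) that] by auto
  have z2: "uxt p = 0" "uxx p = 0" "uxy p = 0" "uyt p = 0" "uyy p = 0" if "p \<notin> K" for p
    unfolding uxt_def uyt_def uxx_def uxy_def uyy_def
    using partial_deriv_eq_0[OF compact_imp_closed[OF K(1)] _ that] z1 by auto
  note smooth_cont = sm[THEN smooth_imp_continuous_on] sm2[THEN smooth_imp_continuous_on]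
  note cont = smooth_cont[THEN continuous_on_subset[OF _ subset_UNIV, of _ U]]
  note duT = sm[THEN smooth_DERIV_line, of _ T, folded ut_def uxt_def uyt_def]
  note duX = sm[THEN smooth_DERIV_line, of _ X, folded ux_def uxx_def, unfolded comm]
  note duY = sm[THEN smooth_DERIV_line, of _ Y, folded uy_def uxy_def uyy_def, unfolded comm]

  define B :: "real \<times> (real ^ 2) \<Rightarrow> real" where "B p = inverse (fst p)" for p
  define x :: "real \<times> (real ^ 2) \<Rightarrow> real" where "x p = snd p $ 1" for p
  define w where "w p = exp (s * ((B p - 1) * x p))" for p
  have contB: "continuous_on U B" "continuous_on U x"
    unfolding B_def x_def U_def by (auto intro!: continuous_intros)
  have contw: "continuous_on U w"
    unfolding w_def by (intro continuous_intros contB)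
  have dBT: "((\<lambda>h. B (p + h *\<^sub>R T)) has_real_derivative - (B p)\<^sup>2) (at 0)" if "p \<in> U" for p
    using that unfolding B_def T_def U_def
    by (auto intro!: derivative_eq_intros simp: power2_eq_square)
  have dB0: "((\<lambda>h. B (p + h *\<^sub>R X)) has_real_derivative 0) (at 0)"
    "((\<lambda>h. B (p + h *\<^sub>R Y)) has_real_derivative 0) (at 0)" for p
    unfolding B_def X_def Y_def by auto
  have dx: "((\<lambda>h. x (p + h *\<^sub>R T)) has_real_derivative 0) (at 0)"
    "((\<lambda>h. x (p + h *\<^sub>R X)) has_real_derivative 1) (at 0)"
    "((\<lambda>h. x (p + h *\<^sub>R Y)) has_real_derivative 0) (at 0)" for p
    unfolding x_def T_def X_def Y_def by (auto intro!: derivative_eq_intros simp: axis_def)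

  \<comment> \<open>Product-rule formulas for \<open>v = w u\<close> and its derivatives. Taken as
    definitions, they leave only derivatives of explicit expressions along the three axes to be
    verified.\<close>
  define v where "v p = w p * u p" for p
  define vt where "vt p = w p * (ut p - s * x p * (B p)\<^sup>2 * u p)" for p
  define v1 where "v1 p = w p * (ux p + s * (B p - 1) * u p)" for p
  define v2 where "v2 p = w p * uy p" for p
  define v11 where "v11 p = w p * (uxx p + 2 * s * (B p - 1) * ux p + s\<^sup>2 * (B p - 1)\<^sup>2 * u p)" for p
  define v12 where "v12 p = w p * (uxy p + s * (B p - 1) * uy p)" for p
  define v22 where "v22 p = w p * uyy p" for p
  define v1t where "v1t p = w p * (uxt p - s * (B p)\<^sup>2 * u p + s * (B p - 1) * ut p
    - s * x p * (B p)\<^sup>2 * (ux p + s * (B p - 1) * u p))" for p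
  define v2t where "v2t p = w p * (uyt p - s * x p * (B p)\<^sup>2 * uy p)" for p
  note v_defs = v_def vt_def v1_def v2_def v11_def v12_def v22_def v1t_def v2t_def
  have contv: "continuous_on U v" "continuous_on U vt" "continuous_on U v1" "continuous_on U v2"
    "continuous_on U v11" "continuous_on U v12" "continuous_on U v22" "continuous_on U v1t" "continuous_on U v2t"
    unfolding v_defs by (intro continuous_intros contw contB cont)+
  have zv: "v p = 0" "vt p = 0" "v1 p = 0" "v2 p = 0" "v11 p = 0" "v12 p = 0" "v22 p = 0" "v1t p = 0" "v2t p = 0"
    if "p \<notin> K" for p
    using K(2)[OF that] z1[OF that] z2[OF that] by (simp_all add: v_defs)

  have dw: "((\<lambda>h. w (p + h *\<^sub>R T)) has_real_derivative - s * x p * (B p)\<^sup>2 * w p) (at 0)"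
    "((\<lambda>h. w (p + h *\<^sub>R X)) has_real_derivative s * (B p - 1) * w p) (at 0)"
    "((\<lambda>h. w (p + h *\<^sub>R Y)) has_real_derivative 0) (at 0)" if "p \<in> U" for p
    unfolding w_def
    by (rule derivative_eq_intros dBT[OF that] dB0 dx refl | simp add: algebra_simps)+
  note D = derivative_eq_intros dw[THEN DERIV_cong] dBT[THEN DERIV_cong] dB0[THEN DERIV_cong] dx[THEN DERIV_cong]
    duT[THEN DERIV_cong] duX[THEN DERIV_cong] duY[THEN DERIV_cong]
  have dvT: "((\<lambda>h. v (p + h *\<^sub>R T)) has_real_derivative vt p) (at 0)"
    "((\<lambda>h. v1 (p + h *\<^sub>R T)) has_real_derivative v1t p) (at 0)"
    "((\<lambda>h. v2 (p + h *\<^sub>R T)) has_real_derivative v2t p) (at 0)" if "p \<in> U" for p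
    unfolding v_defs using that
    by (auto intro!: D simp: algebra_simps power2_eq_square)
  \<comment> \<open>The same \<open>v1t\<close> is the derivative of \<open>v1\<close> along
    \<open>T\<close> and of \<open>vt\<close> along \<open>X\<close>; this rests on
    \<open>comm\<close>. The same holds for \<open>v2t\<close> and \<open>v12\<close> with the other
    pairs of directions.\<close>
  have dvX: "((\<lambda>h. v (p + h *\<^sub>R X)) has_real_derivative v1 p) (at 0)"
    "((\<lambda>h. vt (p + h *\<^sub>R X)) has_real_derivative v1t p) (at 0)"
    "((\<lambda>h. v1 (p + h *\<^sub>R X)) has_real_derivative v11 p) (at 0)"
    "((\<lambda>h. v2 (p + h *\<^sub>R X)) has_real_derivative v12 p) (at 0)" if "p \<in> U" for p
    unfolding v_defs using that
    by (auto intro!: D simp: algebra_simps power2_eq_square)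
  have dvY: "((\<lambda>h. v (p + h *\<^sub>R Y)) has_real_derivative v2 p) (at 0)"
    "((\<lambda>h. vt (p + h *\<^sub>R Y)) has_real_derivative v2t p) (at 0)"
    "((\<lambda>h. v1 (p + h *\<^sub>R Y)) has_real_derivative v12 p) (at 0)"
    "((\<lambda>h. v2 (p + h *\<^sub>R Y)) has_real_derivative v22 p) (at 0)" if "p \<in> U" for p
    unfolding v_defs using that
    by (auto intro!: D simp: algebra_simps power2_eq_square)

  define c where "c p = 2 * s * (B p - 1)" for p
  define f where "f p = s\<^sup>2 * (B p - 1)\<^sup>2 + s * x p * (B p)\<^sup>2" for p
  have contc: "continuous_on U c" "continuous_on U f"
    unfolding c_def f_def by (intro continuous_intros contB)+
  have dc: "((\<lambda>h. c (p + h *\<^sub>R X)) has_real_derivative 0) (at 0)"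
    "((\<lambda>h. c (p + h *\<^sub>R Y)) has_real_derivative 0) (at 0)" for p
    unfolding c_def by (auto intro!: D)
  have df: "((\<lambda>h. f (p + h *\<^sub>R T)) has_real_derivative
        - (2 * s\<^sup>2 * (B p - 1) * (B p)\<^sup>2 + 2 * s * x p * (B p) ^ 3)) (at 0)"
      "((\<lambda>h. f (p + h *\<^sub>R X)) has_real_derivative s * (B p)\<^sup>2) (at 0)" if "p \<in> U" for p
    unfolding f_def using that
    by (auto intro!: D simp: algebra_simps power2_eq_square power3_eq_cube)

  \<comment> \<open>The fluxes come from
    \<open>2 v_t Delta v = div (2 v_t grad v) - d_t |grad v|^2\<close> and, since \<open>c\<close>
    depends on time only, \<open>-2 c v_1 Delta v = -div (2 c v_1 grad v) + d_1 (c |grad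
    v|^2)\<close>; the terms with \<open>f v^2\<close> come from \<open>2 f v v_t\<close> and
    \<open>-2 c f v v_1\<close>. All of them enter with the opposite sign, so that adding the
    divergence cancels them.\<close>
  define FT where "FT p = (v1 p)\<^sup>2 + (v2 p)\<^sup>2 - f p * (v p)\<^sup>2" for p
  define F1 where "F1 p = v p * v1 p - (2 * v1 p * vt p - 2 * c p * (v1 p)\<^sup>2
    + c p * ((v1 p)\<^sup>2 + (v2 p)\<^sup>2) - c p * f p * (v p)\<^sup>2)" for p
  define F2 where "F2 p = v p * v2 p - (2 * v2 p * vt p - 2 * c p * v2 p * v1 p)" for p
  define divT where "divT p = 2 * v1 p * v1t p + 2 * v2 p * v2t p
    + (2 * s\<^sup>2 * (B p - 1) * (B p)\<^sup>2 + 2 * s * x p * (B p) ^ 3) * (v p)\<^sup>2 - 2 * f p * v p * vt p" for p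
  define div1 where "div1 p = (v1 p)\<^sup>2 + v p * v11 p - (2 * v11 p * vt p + 2 * v1 p * v1t p
    - 4 * c p * v1 p * v11 p + c p * (2 * v1 p * v11 p + 2 * v2 p * v12 p)
    - c p * (s * (B p)\<^sup>2) * (v p)\<^sup>2 - 2 * c p * f p * v p * v1 p)" for p
  define div2 where "div2 p = (v2 p)\<^sup>2 + v p * v22 p - (2 * v22 p * vt p + 2 * v2 p * v2t p
    - 2 * c p * (v22 p * v1 p + v2 p * v12 p))" for p
  note D' = derivative_eq_intros dvT[THEN DERIV_cong] dvX[THEN DERIV_cong] dvY[THEN DERIV_cong]
    dc[THEN DERIV_cong] df[THEN DERIV_cong]
  have "((\<lambda>h. FT (p + h *\<^sub>R T)) has_real_derivative divT p) (at 0)" if "p \<in> U" for p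
    unfolding FT_def divT_def using that by (auto intro!: D' simp: algebra_simps)
  moreover have "((\<lambda>h. F1 (p + h *\<^sub>R X)) has_real_derivative div1 p) (at 0)" if "p \<in> U" for p
    unfolding F1_def div1_def using that by (auto intro!: D' simp: algebra_simps power2_eq_square)
  moreover have "((\<lambda>h. F2 (p + h *\<^sub>R Y)) has_real_derivative div2 p) (at 0)" if "p \<in> U" for p
    unfolding F2_def div2_def using that by (auto intro!: D' simp: algebra_simps power2_eq_square)
  moreover have contF: "continuous_on U FT" "continuous_on U F1" "continuous_on U F2"
    "continuous_on U divT" "continuous_on U div1" "continuous_on U div2"
    unfolding FT_def F1_def F2_def divT_def div1_def div2_def
    by (intro continuous_intros contv contc contB)+
  moreover have zF: "FT p = 0" "F1 p = 0" "F2 p = 0" "divT p = 0" "div1 p = 0" "div2 p = 0" if "p \<notin> K" for p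
    unfolding FT_def F1_def F2_def divT_def div1_def div2_def using zv[OF that] by simp_all
  ultimately have int0: "(\<integral>p. divT p \<partial>lborel) = 0" "(\<integral>p. div1 p \<partial>lborel) = 0" "(\<integral>p. div2 p \<partial>lborel) = 0"
    using integral_directional_derivative_eq_0[OF K(1) KU U] by blast+
  have int: "integrable lborel divT" "integrable lborel div1" "integrable lborel div2"
    using contF zF by (auto intro!: integrable_continuous_on_compact[OF K(1)] continuous_on_subset[OF _ KU])
  define G where "G p = 2 * (divT p + div1 p + div2 p)" for p
  have w: "carleman_weight s = w"
    by (auto simp: carleman_weight_def w_def B_def x_def)
  have "s\<^sup>2 * ((B p - 1) * B p) * (w p * u p)\<^sup>2 + s * (w p * u p)\<^sup>2 + (w p)\<^sup>2 * ((ux p)\<^sup>2 + (uy p)\<^sup>2)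
     \<le> 2 * (w p * (ut p + (uxx p + uyy p)))\<^sup>2 + G p" if "p \<in> K" for p
  proof -
    have "1 \<le> B p" "1 \<le> x p"
      using KD[OF that] by (auto simp: B_def x_def one_le_inverse)
    note ineq = carleman_pointwise[OF this s, of "v p" "v1 p" "v2 p" "v11 p" "v22 p" "vt p" "v1t p" "v2t p" "v12 p"]
    \<comment> \<open>Subtracting the part of \<open>v1\<close> in which the derivative falls on the
      weight leaves \<open>w p * ux p\<close>.\<close>
    have e1: "(v1 p - s * (B p - 1) * v p)\<^sup>2 + (v2 p)\<^sup>2 = (w p)\<^sup>2 * ((ux p)\<^sup>2 + (uy p)\<^sup>2)"
      by (simp add: v_defs algebra_simps power2_eq_square)
    \<comment> \<open>The conjugation undone: \<open>S v + N v\<close> is the weight times the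
      operator applied to \<open>u\<close>.\<close>
    have e2: "v11 p + v22 p + (s\<^sup>2 * (B p - 1)\<^sup>2 + s * x p * (B p)\<^sup>2) * v p + (vt p - 2 * s * (B p - 1) * v1 p)
      = w p * (ut p + (uxx p + uyy p))"
      by (simp add: v_defs algebra_simps power2_eq_square)
    show ?thesis
      using ineq unfolding e1 e2 G_def divT_def div1_def div2_def c_def f_def by (simp add: v_def)
  qed
  moreover have "integrable lborel G" "(\<integral>p. G p \<partial>lborel) = 0"
    unfolding G_def using int int0 by simp_all
  moreover have "G p = 0" if "p \<notin> K" for p
    using zF[OF that] by (simp add: G_def)
  ultimately show ?thesis
    by (intro exI[of _ G])
      (simp add: w B_def[symmetric] space_deriv_def time_deriv_def laplacian_def sum_2
        T_def[symmetric] X_def[symmetric] Y_def[symmetric] ut_def[symmetric] ux_def[symmetric] uy_def[symmetric]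
        uxx_def[symmetric] uyy_def[symmetric])
qed

section \<open>Norms on space-time and the geometry of the cone\<close>

lemma L2_norm_on_eq:
  fixes f :: "'a::euclidean_space \<Rightarrow> 'b::real_normed_vector"
  assumes "\<And>p. p \<notin> S \<Longrightarrow> f p = 0"
  shows "L2_norm_on S f = sqrt (\<integral>p. (norm (f p))\<^sup>2 \<partial>lborel)"
proof -
  have "(\<lambda>p. indicator S p *\<^sub>R (norm (f p))\<^sup>2) = (\<lambda>p. (norm (f p))\<^sup>2)"
    using assms by (auto simp: fun_eq_iff indicator_def)
  then show ?thesis unfolding L2_norm_on_def set_lebesgue_integral_def by (simp only:)
qed

lemma norm_vec2_sq: "(norm (x :: real ^ 2))\<^sup>2 = (x $ 1)\<^sup>2 + (x $ 2)\<^sup>2"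
  by (simp only: power2_norm_eq_inner inner_vec_def sum_2) (simp add: power2_eq_square)

text \<open>Among cone points of given norm, \<open>x $ 1\<close> is least on the edges, where
  equality holds. Algebraically, square the cone condition multiplied by the cosine and add
  \<open>(x $ 1 * cos (\<theta> / 2))\<^sup>2\<close>.\<close>

lemma planar_cone_first_coordinate:
  assumes "0 < \<theta>" "\<theta> < pi" "x \<in> planar_cone \<theta>"
  shows "norm x * cos (\<theta> / 2) \<le> x $ 1"
proof (rule power2_le_imp_le)
  have c: "0 < cos (\<theta> / 2)" using assms by (intro cos_gt_zero) auto
  have x: "0 \<le> x $ 1" "\<bar>x $ 2\<bar> \<le> x $ 1 * tan (\<theta> / 2)"
    using assms(3) by (auto simp: planar_cone_def)
  then have "\<bar>x $ 2\<bar> * cos (\<theta> / 2) \<le> x $ 1 * sin (\<theta> / 2)"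
    using c by (simp add: tan_def pos_le_divide_eq)
  then have "(\<bar>x $ 2\<bar> * cos (\<theta> / 2))\<^sup>2 \<le> (x $ 1 * sin (\<theta> / 2))\<^sup>2"
    using c by (intro power_mono) auto
  moreover have "(x $ 1 * sin (\<theta> / 2))\<^sup>2 + (x $ 1 * cos (\<theta> / 2))\<^sup>2 = (x $ 1)\<^sup>2"
    by (simp add: power_mult_distrib flip: distrib_left)
  ultimately show "(norm x * cos (\<theta> / 2))\<^sup>2 \<le> (x $ 1)\<^sup>2"
    by (simp add: power_mult_distrib norm_vec2_sq algebra_simps)
  show "0 \<le> x $ 1" by (fact x(1))
qed

lemma borel_truncated_spacetime_cone: "truncated_spacetime_cone \<theta> R \<in> sets borel"
proof -
  have "closed (planar_cone \<theta>)"
    unfolding planar_cone_def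
    by (intro closed_Collect_conj closed_Collect_le continuous_intros)
  then show ?thesis
    unfolding truncated_spacetime_cone_def by (intro borel_Times sets.Diff borel_closed borel_open) auto
qed

section \<open>The Carleman estimate on the truncated cone\<close>

theorem proposition1p1:
  fixes \<theta> :: real
  assumes "95 * pi / 180 \<le> \<theta>" and "\<theta> < pi"
  shows "\<exists>R\<^sub>0>0. \<forall>R\<ge>R\<^sub>0.
    \<exists>(\<phi> :: real \<times> (real ^ 2) \<Rightarrow> real) (C :: real).
      set_borel_measurable borel (truncated_spacetime_cone \<theta> R) \<phi> \<and>
      C > 0 \<and>
      (\<forall>(t, x) \<in> truncated_spacetime_cone \<theta> R. \<bar>\<phi> (t, x)\<bar> < C * ((norm x)\<^sup>2 / t)) \<and>
      (\<exists>\<tau>\<^sub>0>0. \<exists>K>0. \<forall>\<tau>\<ge>\<tau>\<^sub>0. \<forall>u \<in> test_functions (truncated_spacetime_cone \<theta> R).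
         \<tau> * L2_norm_on (spacetime_cone \<theta>)
               (\<lambda>(t, x). exp (\<tau> * \<phi> (t, x)) * ((1 - t) powr (1 / 2) / t) * u (t, x))
         + \<tau> powr (1 / 2) * L2_norm_on (spacetime_cone \<theta>) (\<lambda>p. exp (\<tau> * \<phi> p) * u p)
         + L2_norm_on (spacetime_cone \<theta>) (\<lambda>p. exp (\<tau> * \<phi> p) *\<^sub>R gradient u p)
         \<le> K * L2_norm_on (spacetime_cone \<theta>)
               (\<lambda>p. exp (\<tau> * \<phi> p) * (time_deriv u p + laplacian u p)))"
proof -
  have \<theta>0: "0 < \<theta>" using assms(1) pi_gt_zero by linarith
  have c: "0 < cos (\<theta> / 2)" using \<theta>0 assms(2) by (intro cos_gt_zero) auto
  define \<phi> :: "real \<times> (real ^ 2) \<Rightarrow> real" where "\<phi> p = (inverse (fst p) - 1) * snd p $ 1" for p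
  \<comment> \<open>The quotient \<open>1 / cos (\<theta> / 2)\<close> forces
    \<open>x_1 \<ge> 1\<close> on the truncated cone; the 1 gives \<open>|x| \<ge> 1\<close>, used
    to pass from \<open>|x|\<close> to \<open>|x|^2\<close> in the bound on the weight.\<close>
  define R\<^sub>0 where "R\<^sub>0 = max 1 (1 / cos (\<theta> / 2))"
  show ?thesis
  proof (intro exI[of _ R\<^sub>0] conjI allI impI)
    show "0 < R\<^sub>0" by (simp add: R\<^sub>0_def)
  next
    fix R assume R: "R\<^sub>0 \<le> R"
    define D where "D = truncated_spacetime_cone \<theta> R"
    have D: "0 < fst p" "fst p < 1" "1 \<le> snd p $ 1" "1 \<le> norm (snd p)" if "p \<in> D" for p
    proof -
      show "0 < fst p" "fst p < 1"
        using that by (auto simp: D_def truncated_spacetime_cone_def)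
      have p: "snd p \<in> planar_cone \<theta>" "R \<le> norm (snd p)"
        using that by (auto simp: D_def truncated_spacetime_cone_def)
      then show "1 \<le> norm (snd p)" using R by (simp add: R\<^sub>0_def)
      have "1 / cos (\<theta> / 2) \<le> norm (snd p)" using p(2) R by (simp add: R\<^sub>0_def)
      then have "1 \<le> norm (snd p) * cos (\<theta> / 2)" using c by (simp add: pos_divide_le_eq)
      also have "\<dots> \<le> snd p $ 1"
        using p(1) \<theta>0 assms(2) by (intro planar_cone_first_coordinate)
      finally show "1 \<le> snd p $ 1" .
    qed
    have DS: "D \<subseteq> spacetime_cone \<theta>"
      by (auto simp: D_def truncated_spacetime_cone_def spacetime_cone_def)
    have cont\<phi>: "continuous_on D \<phi>"
      unfolding \<phi>_def using D(1) by (intro continuous_intros) force+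
    have meas: "set_borel_measurable borel D \<phi>"
      using borel_measurable_continuous_on_indicator[OF _ cont\<phi>] borel_truncated_spacetime_cone
      by (simp add: set_borel_measurable_def D_def)
    \<comment> \<open>Strictness comes from the subtracted \<open>x_1\<close>, which is at least
      1.\<close>
    have bound: "\<bar>\<phi> p\<bar> < 1 * ((norm (snd p))\<^sup>2 / fst p)" if "p \<in> D" for p
    proof -
      note Dp = D[OF that]
      have "\<bar>\<phi> p\<bar> = snd p $ 1 / fst p - snd p $ 1"
        using Dp by (simp add: \<phi>_def abs_mult one_le_inverse field_simps)
      also have "\<dots> < snd p $ 1 / fst p" using Dp by simp
      also have "\<dots> \<le> (norm (snd p))\<^sup>2 / fst p"
      proof (rule divide_right_mono)
        have "snd p $ 1 \<le> norm (snd p)" using component_le_norm_cart[of "snd p" 1] by simp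
        also have "\<dots> \<le> (norm (snd p))\<^sup>2" using Dp(4) by (simp add: self_le_power)
        finally show "snd p $ 1 \<le> (norm (snd p))\<^sup>2" .
      qed (use Dp in simp)
      finally show ?thesis by simp
    qed
    \<comment> \<open>The 6 arises from three terms, each at most twice the norm on the
      right.\<close>
    have carleman: "\<tau> * L2_norm_on (spacetime_cone \<theta>)
               (\<lambda>(t, x). exp (\<tau> * \<phi> (t, x)) * ((1 - t) powr (1 / 2) / t) * u (t, x))
         + \<tau> powr (1 / 2) * L2_norm_on (spacetime_cone \<theta>) (\<lambda>p. exp (\<tau> * \<phi> p) * u p)
         + L2_norm_on (spacetime_cone \<theta>) (\<lambda>p. exp (\<tau> * \<phi> p) *\<^sub>R gradient u p)
         \<le> 6 * L2_norm_on (spacetime_cone \<theta>)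
               (\<lambda>p. exp (\<tau> * \<phi> p) * (time_deriv u p + laplacian u p))"
      if \<tau>: "1 \<le> \<tau>" and "u \<in> test_functions D" for \<tau> u
    proof -
      define K where "K = closure {p. u p \<noteq> 0}"
      have u: "smooth u" and K: "compact K" "K \<subseteq> D"
        using that(2) interior_subset by (auto simp: test_functions_def K_def)
      have uK: "u p = 0" if "p \<notin> K" for p
        using that closure_subset[of "{p. u p \<noteq> 0}"] by (auto simp: K_def)
      define w where "w p = exp (\<tau> * \<phi> p)" for p
      define P where "P p = w p * (time_deriv u p + laplacian u p)" for p
      have weight: "carleman_weight \<tau> = w"
        by (auto simp: carleman_weight_def w_def \<phi>_def)
      obtain G where G: "integrable lborel G" "(\<integral>p. G p \<partial>lborel) = 0" "\<And>p. p \<notin> K \<Longrightarrow> G p = 0"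
        and ineq: "\<And>p. p \<in> K \<Longrightarrow> \<tau>\<^sup>2 * ((inverse (fst p) - 1) * inverse (fst p)) * (w p * u p)\<^sup>2
           + \<tau> * (w p * u p)\<^sup>2 + (w p)\<^sup>2 * ((space_deriv 1 u p)\<^sup>2 + (space_deriv 2 u p)\<^sup>2)
           \<le> 2 * (P p)\<^sup>2 + G p"
      proof -
        have KD: "0 < fst p \<and> fst p < 1 \<and> 1 \<le> snd p $ 1" if "p \<in> K" for p
          using D(1-3) K(2) that by blast
        show thesis
          by (rule exE[OF carleman_divergence[OF u K(1) _ _ \<tau>]], erule uK, erule KD, unfold weight,
              elim conjE, rule that, assumption, assumption, blast) (simp add: P_def)
      qed
      have clK: "closed K" using K(1) by (rule compact_imp_closed)
      have zero: "time_deriv u p = 0" "space_deriv i u p = 0" "laplacian u p = 0" if "p \<notin> K" for p i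
      proof -
        have D0: "time_deriv u q = 0" "space_deriv i u q = 0" if "q \<notin> K" for q i
          using partial_deriv_eq_0[OF clK uK that] by (simp_all add: time_deriv_def space_deriv_def)
        show "time_deriv u p = 0" "space_deriv i u p = 0"
          using D0[OF that] by simp_all
        have "space_deriv j (space_deriv j u) p = 0" for j
          unfolding space_deriv_def[of j "space_deriv j u"]
          by (rule partial_deriv_eq_0[OF clK D0(2) that])
        then show "laplacian u p = 0" by (simp add: laplacian_def)
      qed
      have zP: "P p = 0" if "p \<notin> K" for p
        using zero[OF that] by (simp add: P_def)
      have "continuous_on UNIV (time_deriv u)" "continuous_on UNIV (laplacian u)"
        unfolding time_deriv_def laplacian_def space_deriv_def
        by (intro continuous_intros smooth_imp_continuous_on smooth_partial_deriv u basis_in_Basis)+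
      then have "continuous_on K (\<lambda>p. (P p)\<^sup>2)"
        unfolding P_def w_def
        by (intro continuous_intros continuous_on_subset[OF cont\<phi> K(2)]; blast intro: continuous_on_subset)+
      then have intP: "integrable lborel (\<lambda>p. (P p)\<^sup>2)"
        using zP by (intro integrable_continuous_on_compact[OF K(1)]) auto
      have term1_nonneg: "0 \<le> \<tau>\<^sup>2 * ((inverse (fst p) - 1) * inverse (fst p)) * (w p * u p)\<^sup>2"
        and term2_nonneg: "0 \<le> \<tau> * (w p * u p)\<^sup>2"
        and term3_nonneg: "0 \<le> (w p)\<^sup>2 * ((space_deriv 1 u p)\<^sup>2 + (space_deriv 2 u p)\<^sup>2)" if "p \<in> K" for p
        using D[of p] K(2) that \<tau> by (auto simp: one_le_inverse)
      \<comment> \<open>The three terms on the left of \<open>ineq\<close> are nonnegative on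
        \<open>K\<close>, so each is bounded by the right side alone. The type \<open>'b\<close>
        covers both the scalar terms and the vector-valued gradient.\<close>
      have L2_bound: "sqrt k * L2_norm_on (spacetime_cone \<theta>) F \<le> 2 * L2_norm_on (spacetime_cone \<theta>) P"
        if k: "0 \<le> k" and F: "\<And>p. p \<notin> K \<Longrightarrow> F p = 0"
          and le: "\<And>p. p \<in> K \<Longrightarrow> k * (norm (F p))\<^sup>2 \<le> 2 * (P p)\<^sup>2 + G p"
        for k and F :: "real \<times> (real ^ 2) \<Rightarrow> 'b::real_normed_vector"
      proof -
        \<comment> \<open>Off \<open>K\<close> both sides are zero.\<close>
        have le': "k * (norm (F p))\<^sup>2 \<le> 2 * (P p)\<^sup>2 + G p" for p
          using le[of p] F[of p] zP[of p] G(3)[of p] by (cases "p \<in> K") auto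
        have "(\<integral>p. k * (norm (F p))\<^sup>2 \<partial>lborel) \<le> (\<integral>p. 2 * (P p)\<^sup>2 + G p \<partial>lborel)"
        \<comment> \<open>Only the larger side has to be integrable: if the smaller one were not,
          its integral would be the default 0, still below a nonnegative integral.\<close>
        proof (rule integral_mono')
          show "integrable lborel (\<lambda>p. 2 * (P p)\<^sup>2 + G p)" using intP G(1) by simp
          show "0 \<le> 2 * (P p)\<^sup>2 + G p" for p
            using le'[of p] k by (meson order_trans mult_nonneg_nonneg zero_le_power2)
        qed (rule le')
        then have "k * (\<integral>p. (norm (F p))\<^sup>2 \<partial>lborel) \<le> 2 * (\<integral>p. (P p)\<^sup>2 \<partial>lborel)"
          using intP G(1,2) by simp
        \<comment> \<open>Rounding 2 up to a square gives the constant 2 after taking roots.\<close>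
        also have "\<dots> \<le> 2\<^sup>2 * (\<integral>p. (P p)\<^sup>2 \<partial>lborel)"
          by (intro mult_right_mono) auto
        finally have "sqrt (k * (\<integral>p. (norm (F p))\<^sup>2 \<partial>lborel)) \<le> sqrt (2\<^sup>2 * (\<integral>p. (P p)\<^sup>2 \<partial>lborel))"
          by (rule real_sqrt_le_mono)
        moreover have "F p = 0" "P p = 0" if "p \<notin> spacetime_cone \<theta>" for p
          using that K(2) DS F zP by blast+
        ultimately show ?thesis
          by (simp add: L2_norm_on_eq real_sqrt_mult)
      qed
      have "sqrt (\<tau>\<^sup>2) * L2_norm_on (spacetime_cone \<theta>)
          (\<lambda>p. w p * ((1 - fst p) powr (1 / 2) / fst p) * u p) \<le> 2 * L2_norm_on (spacetime_cone \<theta>) P"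
      proof (rule L2_bound)
        fix p assume p: "p \<in> K"
        then have "0 < fst p" "fst p < 1" using D K(2) by blast+
        \<comment> \<open>Both sides are \<open>(1 - t) / t^2\<close>, which matches the weight of
          the norm to the coefficient in \<open>ineq\<close>.\<close>
        then have "((1 - fst p) powr (1 / 2) / fst p)\<^sup>2 = (inverse (fst p) - 1) * inverse (fst p)"
          by (simp add: powr_half_sqrt power_divide) (simp add: field_simps power2_eq_square)
        then have "\<tau>\<^sup>2 * (norm (w p * ((1 - fst p) powr (1 / 2) / fst p) * u p))\<^sup>2
          = \<tau>\<^sup>2 * ((inverse (fst p) - 1) * inverse (fst p)) * (w p * u p)\<^sup>2"
          by (simp only: real_norm_def power2_abs power_mult_distrib mult_ac)
        then show "\<tau>\<^sup>2 * (norm (w p * ((1 - fst p) powr (1 / 2) / fst p) * u p))\<^sup>2 \<le> 2 * (P p)\<^sup>2 + G p"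
          using ineq[OF p] term2_nonneg[OF p] term3_nonneg[OF p] by linarith
      qed (use uK in simp_all)
      moreover have "sqrt \<tau> * L2_norm_on (spacetime_cone \<theta>) (\<lambda>p. w p * u p)
          \<le> 2 * L2_norm_on (spacetime_cone \<theta>) P"
      proof (rule L2_bound)
        fix p assume p: "p \<in> K"
        show "\<tau> * (norm (w p * u p))\<^sup>2 \<le> 2 * (P p)\<^sup>2 + G p"
          using ineq[OF p] term1_nonneg[OF p] term3_nonneg[OF p]
          by (simp only: real_norm_def power2_abs)
      qed (use uK \<tau> in simp_all)
      moreover have "sqrt 1 * L2_norm_on (spacetime_cone \<theta>) (\<lambda>p. w p *\<^sub>R gradient u p)
          \<le> 2 * L2_norm_on (spacetime_cone \<theta>) P"
      proof (rule L2_bound)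
        fix p assume p: "p \<in> K"
        have "(norm (w p *\<^sub>R gradient u p))\<^sup>2 = (w p)\<^sup>2 * ((space_deriv 1 u p)\<^sup>2 + (space_deriv 2 u p)\<^sup>2)"
          by (simp add: power_mult_distrib norm_vec2_sq gradient_def)
        then show "1 * (norm (w p *\<^sub>R gradient u p))\<^sup>2 \<le> 2 * (P p)\<^sup>2 + G p"
          using ineq[OF p] term1_nonneg[OF p] term2_nonneg[OF p] by linarith
      qed (simp_all add: gradient_def zero vec_eq_iff)
      ultimately show ?thesis
        using \<tau> by (simp add: w_def[abs_def] P_def[abs_def] powr_half_sqrt case_prod_unfold)
    qed
    have "\<forall>(t, x)\<in>D. \<bar>\<phi> (t, x)\<bar> < 1 * ((norm x)\<^sup>2 / t)"
      using bound by fastforce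
    then show "\<exists>(\<phi> :: real \<times> (real ^ 2) \<Rightarrow> real) (C :: real).
      set_borel_measurable borel (truncated_spacetime_cone \<theta> R) \<phi> \<and>
      C > 0 \<and>
      (\<forall>(t, x) \<in> truncated_spacetime_cone \<theta> R. \<bar>\<phi> (t, x)\<bar> < C * ((norm x)\<^sup>2 / t)) \<and>
      (\<exists>\<tau>\<^sub>0>0. \<exists>K>0. \<forall>\<tau>\<ge>\<tau>\<^sub>0. \<forall>u \<in> test_functions (truncated_spacetime_cone \<theta> R).
         \<tau> * L2_norm_on (spacetime_cone \<theta>)
               (\<lambda>(t, x). exp (\<tau> * \<phi> (t, x)) * ((1 - t) powr (1 / 2) / t) * u (t, x))
         + \<tau> powr (1 / 2) * L2_norm_on (spacetime_cone \<theta>) (\<lambda>p. exp (\<tau> * \<phi> p) * u p)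
         + L2_norm_on (spacetime_cone \<theta>) (\<lambda>p. exp (\<tau> * \<phi> p) *\<^sub>R gradient u p)
         \<le> K * L2_norm_on (spacetime_cone \<theta>)
               (\<lambda>p. exp (\<tau> * \<phi> p) * (time_deriv u p + laplacian u p)))"
      unfolding D_def[symmetric] using meas carleman
      by (intro exI[of _ \<phi>] exI[of _ 1] conjI exI[of _ 6] allI impI ballI) (assumption | rule zero_less_one | simp)+
  qed
qed

end
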